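(* Let $N\ge 2$, let $m_1,\dots,m_N>0$ be masses, $G>0$, and let $q_i^0,v_i^0\in\mathbb{R}^3$ ($1\le i\le N$) satisfy $q_i^0\neq q_j^0$ for all $1\le i<j\le N$. Let $(Q,V)=(Q_1,\ldots,Q_N,V_1,\ldots,V_N)\in\mathbb{R}^{6N}[[\tau]]$ be the power series solution of the time-renormalized equations $$\frac{dQ_i}{d\tau}=s(Q,V)\,V_i,\qquad \frac{dV_i}{d\tau}=s(Q,V)\,g_i(Q),\qquad Q_i(0)=q_i^0,\quad V_i(0)=v_i^0,\qquad i=1,\ldots,N.$$ Let $(\xi,\zeta)\in\mathbb{R}_+[[\tau]]\times\mathbb{R}_+[[\tau]]$ be the power series solution of the initial value problem $$\xi'=(1+\zeta)\,(2-\chi(\xi,\zeta))^{-1/2},\quad \xi(0)=1,\qquad\qquad \zeta'=\frac{\xi\,(2-\chi(\xi,\zeta))^{-1/2}}{(2-\xi^2)^{3/2}},\quad \zeta(0)=0,$$ where $\chi(\xi,\zeta)=(2-\xi^2)^{-1}\,\big(2\zeta+\zeta^2+(2-\xi^2)^{-1/2}\big)$. Then, for $1\le i<j\le N$, $$Q_i-Q_j\trianglelefteq\|q_i^0-q_j^0\|\,\xi,\qquad V_i-V_j\trianglelefteq\|v_i^0-v_j^0\|+s(q^0,v^0)\,M_{ij}(q^0)\,\zeta .$$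
   Context: $\mathbb{R}_+=\{x\in\mathbb{R}: x\ge 0\}$ and $\|\cdot\|$ is the Euclidean norm. For $f=\sum_{k\ge0}f_k\tau^k\in\mathbb{R}^n[[\tau]]$ and $\bar f=\sum_{k\ge0}\bar f_k\tau^k\in\mathbb{R}[[\tau]]$, $f\trianglelefteq\bar f$ means $\|f_k\|\le\bar f_k$ for all $k\ge0$. Derivatives of formal power series are termwise; for a scalar series $p$ with positive constant term and real $\nu$, $p^\nu$ denotes the usual formal power series. For $Q=(Q_1,\dots,Q_N)$, $V=(V_1,\dots,V_N)$ with $Q_i\ne Q_j$ for $i\neq j$: $$g_i(Q)=\sum_{j\neq i}\frac{G\,m_j}{\|Q_i-Q_j\|^3}(Q_j-Q_i),\qquad K_i(Q)=\sum_{j\neq i}\frac{G\,m_j}{\|Q_i-Q_j\|^2},\qquad M_{ij}(Q)=K_i(Q)+K_j(Q),$$ and the time-renormalization function is $$s(Q,V)=\left(\sum_{1\le i<j\le N}\frac{\|V_i-V_j\|^2}{\|Q_i-Q_j\|^2}+\sum_{1\le i<j\le N}\frac{M_{ij}(Q)}{\|Q_i-Q_j\|}\right)^{-1/2}.$$ Also $q^0=(q_1^0,\dots,q_N^0)$, $v^0=(v_1^0,\dots,v_N^0)$. *)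

theory Defs
  imports "HOL-Analysis.Analysis"
begin

text \<open>
  For \<open>p\<close> with constant term \<open>c > 0\<close>, \<open>p\<^sup>\<nu> = c\<^sup>\<nu> (1 + u)\<^sup>\<nu>\<close> with \<open>u = p / c - 1\<close>, where \<open>u\<close> has zero
  constant term and is substituted into the binomial series.
\<close>

definition fps_powr :: "real fps \<Rightarrow> real \<Rightarrow> real fps" where
  "fps_powr p \<nu> = fps_const (fps_nth p 0 powr \<nu>) *
     (fps_binomial \<nu> oo (fps_const (inverse (fps_nth p 0)) * p - 1))"

lemma fps_powr_nth_0: "fps_nth (fps_powr p \<nu>) 0 = fps_nth p 0 powr \<nu>"
  by (simp add: fps_powr_def)

lemma fps_powr_one:
  assumes "fps_nth p 0 > 0"
  shows "fps_powr p 1 = p"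
proof -
  let ?c = "fps_nth p 0"
  have "fps_binomial (1::real) = 1 + fps_X"
    using fps_binomial_of_nat[of 1, where ?'a = real] by simp
  then have "fps_powr p 1 = fps_const ?c * (fps_const (inverse ?c) * p)"
    using assms by (simp add: fps_powr_def fps_compose_add_distrib)
  also have "\<dots> = p"
    using assms by (simp add: mult.assoc [symmetric])
  finally show ?thesis .
qed

lemma fps_powr_add:
  assumes "fps_nth p 0 > 0"
  shows "fps_powr p (\<mu> + \<nu>) = fps_powr p \<mu> * fps_powr p \<nu>"
proof -
  let ?c = "fps_nth p 0"
  let ?u = "fps_const (inverse ?c) * p - 1"
  have "fps_nth ?u 0 = 0"
    using assms by simp
  then have "fps_binomial (\<mu> + \<nu>) oo ?u = (fps_binomial \<mu> oo ?u) * (fps_binomial \<nu> oo ?u)"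
    by (simp add: fps_binomial_add_mult fps_compose_mult_distrib)
  then show ?thesis
    by (simp add: fps_powr_def powr_add fps_const_mult [symmetric] mult_ac del: fps_const_mult)
qed

text \<open>
  The library operations on \<^typ>\<open>'a fps\<close> that involve products need a ring of coefficients, so
  their analogues for vector coefficients are given here. The products are Cauchy products.
\<close>

definition fps_vderiv :: "'a::real_vector fps \<Rightarrow> 'a fps" where
  "fps_vderiv f = Abs_fps (\<lambda>n. real (Suc n) *\<^sub>R fps_nth f (Suc n))"

definition fps_scale :: "real fps \<Rightarrow> 'a::real_vector fps \<Rightarrow> 'a fps" where
  "fps_scale a f = Abs_fps (\<lambda>n. \<Sum>k=0..n. fps_nth a k *\<^sub>R fps_nth f (n - k))"

definition fps_inner :: "'a::real_inner fps \<Rightarrow> 'a fps \<Rightarrow> real fps" where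
  "fps_inner f g = Abs_fps (\<lambda>n. \<Sum>k=0..n. fps_nth f k \<bullet> fps_nth g (n - k))"

text \<open>Meaningful only if the constant term of \<open>f\<close> is nonzero.\<close>

definition fps_norm :: "'a::real_inner fps \<Rightarrow> real fps" where
  "fps_norm f = fps_powr (fps_inner f f) (1 / 2)"

lemma fps_norm_nth_0: "fps_nth (fps_norm f) 0 = norm (fps_nth f 0)"
  by (simp add: fps_norm_def fps_powr_nth_0 fps_inner_def norm_eq_sqrt_inner powr_half_sqrt)

definition majorized :: "'a::real_normed_vector fps \<Rightarrow> real fps \<Rightarrow> bool"
    (infix \<open>\<unlhd>\<close> 50) where
  "f \<unlhd> F \<longleftrightarrow> (\<forall>k. norm (fps_nth f k) \<le> fps_nth F k)"

text \<open>
  The bodies are indexed by \<open>{1..N}\<close>; values of a configuration outside this range are irrelevant.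
\<close>

definition nbody_K :: "nat \<Rightarrow> real \<Rightarrow> (nat \<Rightarrow> real) \<Rightarrow> (nat \<Rightarrow> real^3) \<Rightarrow> nat \<Rightarrow> real" where
  "nbody_K N G m Q i = (\<Sum>j\<in>{1..N} - {i}. G * m j / norm (Q i - Q j) ^ 2)"

definition nbody_M :: "nat \<Rightarrow> real \<Rightarrow> (nat \<Rightarrow> real) \<Rightarrow> (nat \<Rightarrow> real^3) \<Rightarrow> nat \<Rightarrow> nat \<Rightarrow> real" where
  "nbody_M N G m Q i j = nbody_K N G m Q i + nbody_K N G m Q j"

definition nbody_s ::
    "nat \<Rightarrow> real \<Rightarrow> (nat \<Rightarrow> real) \<Rightarrow> (nat \<Rightarrow> real^3) \<Rightarrow> (nat \<Rightarrow> real^3) \<Rightarrow> real" where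
  "nbody_s N G m Q V =
     ((\<Sum>i\<in>{1..N}. \<Sum>j\<in>{i<..N}. norm (V i - V j) ^ 2 / norm (Q i - Q j) ^ 2) +
      (\<Sum>i\<in>{1..N}. \<Sum>j\<in>{i<..N}. nbody_M N G m Q i j / norm (Q i - Q j))) powr (- 1 / 2)"

text \<open>
  The same functions, and the gravitational field \<open>g\<close>, evaluated at formal power series. The square
  of \<^term>\<open>V i - V j\<close> is written with \<^const>\<open>fps_inner\<close> because its constant term may vanish.
\<close>

definition fps_nbody_g ::
    "nat \<Rightarrow> real \<Rightarrow> (nat \<Rightarrow> real) \<Rightarrow> (nat \<Rightarrow> (real^3) fps) \<Rightarrow> nat \<Rightarrow> (real^3) fps" where
  "fps_nbody_g N G m Q i =
     (\<Sum>j\<in>{1..N} - {i}. fps_scale (fps_const (G * m j) / fps_norm (Q i - Q j) ^ 3) (Q j - Q i))"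

definition fps_nbody_K ::
    "nat \<Rightarrow> real \<Rightarrow> (nat \<Rightarrow> real) \<Rightarrow> (nat \<Rightarrow> (real^3) fps) \<Rightarrow> nat \<Rightarrow> real fps" where
  "fps_nbody_K N G m Q i =
     (\<Sum>j\<in>{1..N} - {i}. fps_const (G * m j) / fps_norm (Q i - Q j) ^ 2)"

definition fps_nbody_M ::
    "nat \<Rightarrow> real \<Rightarrow> (nat \<Rightarrow> real) \<Rightarrow> (nat \<Rightarrow> (real^3) fps) \<Rightarrow> nat \<Rightarrow> nat \<Rightarrow> real fps" where
  "fps_nbody_M N G m Q i j = fps_nbody_K N G m Q i + fps_nbody_K N G m Q j"

definition fps_nbody_s ::
    "nat \<Rightarrow> real \<Rightarrow> (nat \<Rightarrow> real) \<Rightarrow> (nat \<Rightarrow> (real^3) fps) \<Rightarrow> (nat \<Rightarrow> (real^3) fps) \<Rightarrow> real fps" where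
  "fps_nbody_s N G m Q V = fps_powr
     ((\<Sum>i\<in>{1..N}. \<Sum>j\<in>{i<..N}. fps_inner (V i - V j) (V i - V j) / fps_norm (Q i - Q j) ^ 2) +
      (\<Sum>i\<in>{1..N}. \<Sum>j\<in>{i<..N}. fps_nbody_M N G m Q i j / fps_norm (Q i - Q j))) (- 1 / 2)"

lemma fps_nbody_K_nth_0:
  assumes "\<And>j. j \<in> {1..N} \<Longrightarrow> j \<noteq> i \<Longrightarrow> fps_nth (Q i) 0 \<noteq> fps_nth (Q j) 0"
  shows "fps_nth (fps_nbody_K N G m Q i) 0 = nbody_K N G m (\<lambda>i. fps_nth (Q i) 0) i"
  using assms
  by (auto simp: fps_nbody_K_def nbody_K_def fps_sum_nth fps_divide_unit fps_norm_nth_0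
        fps_nth_power_0 divide_inverse intro!: sum.cong)

lemma fps_nbody_s_nth_0:
  assumes sep: "\<And>i j. i \<in> {1..N} \<Longrightarrow> j \<in> {1..N} \<Longrightarrow> i \<noteq> j \<Longrightarrow> fps_nth (Q i) 0 \<noteq> fps_nth (Q j) 0"
  shows "fps_nth (fps_nbody_s N G m Q V) 0 =
    nbody_s N G m (\<lambda>i. fps_nth (Q i) 0) (\<lambda>i. fps_nth (V i) 0)"
proof -
  have unit: "fps_nth (fps_norm (Q i - Q j)) 0 \<noteq> 0" if "i \<in> {1..N}" "j \<in> {i<..N}" for i j
    using sep[of i j] that by (auto simp: fps_norm_nth_0)
  have 1: "fps_nth (fps_inner (V i - V j) (V i - V j) / fps_norm (Q i - Q j) ^ 2) 0 =
      norm (fps_nth (V i) 0 - fps_nth (V j) 0) ^ 2 / norm (fps_nth (Q i) 0 - fps_nth (Q j) 0) ^ 2"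
    if "i \<in> {1..N}" "j \<in> {i<..N}" for i j
    using unit[OF that]
    by (simp add: fps_divide_unit fps_nth_power_0 fps_inner_def power2_norm_eq_inner
        fps_norm_nth_0 divide_inverse)
  have 2: "fps_nth (fps_nbody_M N G m Q i j / fps_norm (Q i - Q j)) 0 =
      nbody_M N G m (\<lambda>i. fps_nth (Q i) 0) i j / norm (fps_nth (Q i) 0 - fps_nth (Q j) 0)"
    if "i \<in> {1..N}" "j \<in> {i<..N}" for i j
  proof -
    have "fps_nth (fps_nbody_K N G m Q k) 0 = nbody_K N G m (\<lambda>i. fps_nth (Q i) 0) k"
      if "k \<in> {1..N}" for k
      using sep that by (intro fps_nbody_K_nth_0) blast
    then show ?thesis
      using unit[OF that] that
      by (simp add: fps_divide_unit fps_nbody_M_def nbody_M_def fps_norm_nth_0 divide_inverse)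
  qed
  show ?thesis
    using 1 2 by (simp add: fps_nbody_s_def nbody_s_def fps_powr_nth_0 fps_sum_nth)
qed

definition nbody_solution ::
    "nat \<Rightarrow> real \<Rightarrow> (nat \<Rightarrow> real) \<Rightarrow> (nat \<Rightarrow> real^3) \<Rightarrow> (nat \<Rightarrow> real^3) \<Rightarrow>
     (nat \<Rightarrow> (real^3) fps) \<Rightarrow> (nat \<Rightarrow> (real^3) fps) \<Rightarrow> bool" where
  "nbody_solution N G m q0 v0 Q V \<longleftrightarrow> (\<forall>i\<in>{1..N}.
     fps_vderiv (Q i) = fps_scale (fps_nbody_s N G m Q V) (V i) \<and>
     fps_vderiv (V i) = fps_scale (fps_nbody_s N G m Q V) (fps_nbody_g N G m Q i) \<and>
     fps_nth (Q i) 0 = q0 i \<and> fps_nth (V i) 0 = v0 i)"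

definition chi :: "real fps \<Rightarrow> real fps \<Rightarrow> real fps" where
  "chi \<xi> \<zeta> = inverse (2 - \<xi>\<^sup>2) * (2 * \<zeta> + \<zeta>\<^sup>2 + fps_powr (2 - \<xi>\<^sup>2) (- 1 / 2))"

definition majorant_solution :: "real fps \<Rightarrow> real fps \<Rightarrow> bool" where
  "majorant_solution \<xi> \<zeta> \<longleftrightarrow>
     fps_deriv \<xi> = (1 + \<zeta>) * fps_powr (2 - chi \<xi> \<zeta>) (- 1 / 2) \<and> fps_nth \<xi> 0 = 1 \<and>
     fps_deriv \<zeta> = \<xi> * fps_powr (2 - chi \<xi> \<zeta>) (- 1 / 2) / fps_powr (2 - \<xi>\<^sup>2) (3 / 2) \<and>
     fps_nth \<zeta> 0 = 0"

end

theory Submission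
  imports Defs
begin

text \<open>
  Write \<open>d = \<parallel>q\<^sub>i\<^sup>0 - q\<^sub>j\<^sup>0\<parallel>\<close>, \<open>w = \<parallel>v\<^sub>i\<^sup>0 - v\<^sub>j\<^sup>0\<parallel>\<close>, \<open>M = M\<^sub>i\<^sub>j(q\<^sup>0)\<close>, \<open>s = s(q\<^sup>0, v\<^sup>0)\<close> and let
  \<open>\<rho> = (2 - \<xi>\<^sup>2)\<close> to the power \<open>-1/2\<close> and \<open>\<sigma> = (2 - \<chi>)\<close> to the power \<open>-1/2\<close>. The proof is Cauchy's
  method of majorants. The coefficient of order \<open>n + 1\<close> of a solution is determined, through the
  equations, by those of order at most \<open>n\<close>. So it suffices to show that if the claimed bounds on the
  differences \<open>Q\<^sub>i - Q\<^sub>j\<close> and \<open>V\<^sub>i - V\<^sub>j\<close> hold up to order \<open>n\<close>, then the right-hand sides of their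
  equations are dominated up to order \<open>n\<close> by the derivatives of the claimed bounds.

  Majorization respects sums, Cauchy products and composition. The binomial series with a
  negative exponent has alternating coefficients, hence \<open>p \<unlhd> p\<^sub>0 U\<close> with \<open>U\<^sub>0 = 1\<close> implies that
  \<open>p\<close> to the power \<open>-\<alpha>\<close> is majorized by \<open>p\<^sub>0\<close> to the power \<open>-\<alpha>\<close> times \<open>2 - U\<close> to the power \<open>-\<alpha>\<close>
  (lemma \<open>majorized_upto_powr_minus\<close>). This single rule, applied with \<open>U = \<xi>\<^sup>2\<close>, bounds all inverse
  distances: \<open>1 / \<parallel>Q\<^sub>i - Q\<^sub>j\<parallel> \<unlhd> \<rho> / d\<close>. Consequently \<open>g\<^sub>i - g\<^sub>j \<unlhd> M \<xi> \<rho>\<^sup>3\<close>.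

  Applied with \<open>U = \<chi>\<close> it gives \<open>s(Q, V) \<unlhd> s \<sigma>\<close>, provided that the series under the root in the
  definition of \<open>s(Q, V)\<close> is majorized by its constant term times \<open>\<chi>\<close>. This holds for every
  pair separately (lemma \<open>pair_term_majorized\<close>), because
  \<open>\<rho>\<^sup>2 (w + s M \<zeta>)\<^sup>2 / d\<^sup>2 + M \<rho>\<^sup>3 / d \<unlhd> (w\<^sup>2 / d\<^sup>2 + M / d) \<rho>\<^sup>2 (2 \<zeta> + \<zeta>\<^sup>2 + \<rho>)\<close>. What makes this work is the
  choice of \<open>s\<close>: as \<open>1 / s\<^sup>2\<close> is the sum of all \<open>w\<^sup>2 / d\<^sup>2 + M / d\<close>, each pair satisfies \<open>s w \<le> d\<close>
  and \<open>s\<^sup>2 M \<le> d\<close>. The same two inequalities yield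
  \<open>s \<sigma> (w + s M \<zeta>) \<unlhd> d (1 + \<zeta>) \<sigma> = d \<xi>'\<close>, the bound for \<open>Q\<^sub>i - Q\<^sub>j\<close>, while for \<open>V\<^sub>i - V\<^sub>j\<close> one gets
  \<open>s \<sigma> M \<xi> \<rho>\<^sup>3 = s M \<zeta>'\<close>.
\<close>

section \<open>Majorization up to a given order\<close>

text \<open>
  Truncating the order makes majorization usable as an induction hypothesis: products, compositions
  and powers up to order \<open>n\<close> involve only coefficients up to order \<open>n\<close>.
\<close>

definition majorized_upto :: "nat \<Rightarrow> 'a::real_normed_vector fps \<Rightarrow> real fps \<Rightarrow> bool" where
  "majorized_upto n f F \<longleftrightarrow> (\<forall>k\<le>n. norm (fps_nth f k) \<le> fps_nth F k)"

lemma majorized_uptoD: "majorized_upto n f F \<Longrightarrow> k \<le> n \<Longrightarrow> norm (fps_nth f k) \<le> fps_nth F k"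
  by (simp add: majorized_upto_def)

lemma majorized_iff_upto: "f \<unlhd> F \<longleftrightarrow> (\<forall>n. majorized_upto n f F)"
  by (auto simp: majorized_def majorized_upto_def)

lemma majorized_upto_trans:
  fixes F :: "real fps"
  shows "majorized_upto n f F \<Longrightarrow> majorized_upto n F H \<Longrightarrow> majorized_upto n f H"
  unfolding majorized_upto_def by (force intro: order_trans)

lemma fps_mult_nonneg:
  fixes f g :: "real fps"
  shows "(\<And>k. fps_nth f k \<ge> 0) \<Longrightarrow> (\<And>k. fps_nth g k \<ge> 0) \<Longrightarrow> fps_nth (f * g) k \<ge> 0"
  by (simp add: fps_mult_nth sum_nonneg)

lemma majorized_upto_const: "\<bar>c\<bar> \<le> C \<Longrightarrow> majorized_upto n (fps_const c) (fps_const C)"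
  by (simp add: majorized_upto_def)

lemma majorized_upto_add:
  "majorized_upto n f F \<Longrightarrow> majorized_upto n g H \<Longrightarrow> majorized_upto n (f + g) (F + H)"
  by (auto simp: majorized_upto_def intro!: norm_triangle_le add_mono)

lemma majorized_upto_diff:
  "majorized_upto n f F \<Longrightarrow> majorized_upto n g H \<Longrightarrow> majorized_upto n (f - g) (F + H)"
  by (auto simp: majorized_upto_def intro!: norm_triangle_le_diff add_mono)

lemma majorized_upto_sum:
  "(\<And>i. i \<in> A \<Longrightarrow> majorized_upto n (f i) (F i)) \<Longrightarrow>
    majorized_upto n (\<Sum>i\<in>A. f i) (\<Sum>i\<in>A. F i)"
  by (auto simp: majorized_upto_def fps_sum_nth intro!: sum_norm_le)

text \<open>
  Serves at once for the product of scalar series, the scaling of a vector series and the inner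
  product of vector series.
\<close>

lemma norm_cauchy_product_le:
  fixes h :: "'a::real_normed_vector \<Rightarrow> 'b::real_normed_vector \<Rightarrow> 'c::real_normed_vector"
  assumes h: "\<And>x y. norm (h x y) \<le> norm x * norm y"
    and "majorized_upto n f F" "majorized_upto n g H" "k \<le> n"
  shows "norm (\<Sum>i=0..k. h (fps_nth f i) (fps_nth g (k - i))) \<le> fps_nth (F * H) k"
  unfolding fps_mult_nth
proof (rule sum_norm_le)
  fix i assume i: "i \<in> {0..k}"
  have "norm (h (fps_nth f i) (fps_nth g (k - i)))
      \<le> norm (fps_nth f i) * norm (fps_nth g (k - i))"
    by (rule h)
  also have "\<dots> \<le> fps_nth F i * fps_nth H (k - i)"
    using majorized_uptoD[OF assms(2), of i] majorized_uptoD[OF assms(3), of "k - i"] i \<open>k \<le> n\<close>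
    by (intro mult_mono order_trans[OF norm_ge_zero]) auto
  finally show "norm (h (fps_nth f i) (fps_nth g (k - i))) \<le> fps_nth F i * fps_nth H (k - i)" .
qed

lemma majorized_upto_mult:
  fixes f g :: "real fps"
  assumes "majorized_upto n f F" "majorized_upto n g H"
  shows "majorized_upto n (f * g) (F * H)"
  using norm_cauchy_product_le[of "(*)", OF _ assms]
  by (simp add: majorized_upto_def fps_mult_nth abs_mult)

lemma majorized_upto_scale:
  assumes "majorized_upto n a A" "majorized_upto n f F"
  shows "majorized_upto n (fps_scale a f) (A * F)"
  using norm_cauchy_product_le[of scaleR, OF _ assms]
  by (simp add: majorized_upto_def fps_scale_def)

lemma majorized_upto_inner:
  assumes "majorized_upto n f F" "majorized_upto n g H"
  shows "majorized_upto n (fps_inner f g) (F * H)"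
  using norm_cauchy_product_le[of inner, OF _ assms]
  by (simp add: majorized_upto_def fps_inner_def Cauchy_Schwarz_ineq2)

lemma majorized_upto_power:
  fixes f :: "real fps"
  assumes "majorized_upto n f F"
  shows "majorized_upto n (f ^ k) (F ^ k)"
proof (induction k)
  case 0
  show ?case by (simp add: majorized_upto_def)
next
  case (Suc k)
  show ?case using majorized_upto_mult[OF assms Suc] by simp
qed

lemma majorized_upto_compose:
  fixes f u :: "real fps"
  assumes "majorized_upto n f F" "majorized_upto n u U"
  shows "majorized_upto n (f oo u) (F oo U)"
  unfolding majorized_upto_def fps_compose_nth
proof (intro allI impI sum_norm_le)
  fix k i assume "k \<le> n" "i \<in> {0..k}"
  then show "norm (fps_nth f i * fps_nth (u ^ i) k) \<le> fps_nth F i * fps_nth (U ^ i) k"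
    using majorized_uptoD[OF assms(1), of i]
      majorized_uptoD[OF majorized_upto_power[OF assms(2)], of k i]
    by (auto simp: abs_mult intro!: mult_mono)
qed

text \<open>The step from order \<open>n\<close> to order \<open>n + 1\<close>: a differential equation gains one order.\<close>

lemma majorized_upto_integrate:
  assumes "norm (fps_nth f 0) \<le> fps_nth F 0"
    and "majorized_upto n (fps_vderiv f) (fps_deriv F)"
  shows "majorized_upto (Suc n) f F"
  unfolding majorized_upto_def
proof (intro allI impI)
  fix k assume k: "k \<le> Suc n"
  show "norm (fps_nth f k) \<le> fps_nth F k"
  proof (cases k)
    case 0
    then show ?thesis using assms(1) by simp
  next
    case (Suc l)
    with k majorized_uptoD[OF assms(2), of l]
    have "real (Suc l) * norm (fps_nth f k) \<le> real (Suc l) * fps_nth F k"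
      by (simp add: fps_vderiv_def)
    then show ?thesis by simp
  qed
qed

section \<open>Negative powers of power series\<close>

lemma fps_powr_zero: "fps_nth p 0 > 0 \<Longrightarrow> fps_powr p 0 = 1"
  by (simp add: fps_powr_def)

lemma fps_powr_minus:
  assumes "fps_nth p 0 > 0"
  shows "fps_powr p (- \<nu>) = inverse (fps_powr p \<nu>)"
proof -
  have "fps_powr p \<nu> * fps_powr p (- \<nu>) = 1"
    using fps_powr_add[OF assms, of \<nu> "- \<nu>"] fps_powr_zero[OF assms] by simp
  then show ?thesis by (metis fps_inverse_unique)
qed

lemma fps_powr_power:
  assumes "fps_nth p 0 > 0"
  shows "fps_powr p \<nu> ^ k = fps_powr p (real k * \<nu>)"
  by (induction k) (simp_all add: fps_powr_zero[OF assms] fps_powr_add[OF assms, symmetric]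
        distrib_right)

text \<open>
  \<open>(- \<alpha>) gchoose k\<close> has sign \<open>(-1)\<^sup>k\<close>, so taking absolute values in the series of \<open>(1 + x)\<close> to the
  power \<open>- \<alpha>\<close> amounts to replacing \<open>x\<close> by \<open>- x\<close>.
\<close>

lemma abs_gbinomial_minus:
  fixes \<alpha> :: real
  assumes "\<alpha> \<ge> 0"
  shows "\<bar>(- \<alpha>) gchoose k\<bar> = (-1) ^ k * ((- \<alpha>) gchoose k)"
proof -
  have "((- \<alpha>) gchoose k) = (-1) ^ k * (pochhammer \<alpha> k / fact k)"
    by (simp add: gbinomial_pochhammer)
  moreover have "pochhammer \<alpha> k / fact k \<ge> 0"
    using assms by (simp add: pochhammer_prod prod_nonneg)
  ultimately show ?thesis
    by (simp only: abs_mult power_abs abs_of_nonneg mult.assoc[symmetric]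
        power_mult_distrib[symmetric]) simp
qed

text \<open>
  With \<open>p = c (1 + u)\<close> and \<open>u \<unlhd> U - 1\<close>, the absolute values of the binomial coefficients turn
  \<open>1 + u\<close> into \<open>1 - (U - 1) = 2 - U\<close>. This is where the expressions \<open>2 - \<xi>\<^sup>2\<close> and \<open>2 - \<chi>\<close> in the
  majorant system come from.
\<close>

lemma majorized_upto_powr_minus:
  assumes "\<alpha> \<ge> 0" and p0: "fps_nth p 0 > 0" and U0: "fps_nth U 0 = 1"
    and p: "majorized_upto n p (fps_const (fps_nth p 0) * U)"
  shows "majorized_upto n (fps_powr p (- \<alpha>))
    (fps_const (fps_nth p 0 powr - \<alpha>) * fps_powr (2 - U) (- \<alpha>))"
proof -
  let ?c = "fps_nth p 0"
  let ?u = "fps_const (inverse ?c) * p - 1"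
  let ?B = "Abs_fps (\<lambda>k. \<bar>(- \<alpha>) gchoose k\<bar>)"
  have u: "majorized_upto n ?u (U - 1)"
    unfolding majorized_upto_def
  proof (intro allI impI)
    fix k assume "k \<le> n"
    then show "norm (fps_nth ?u k) \<le> fps_nth (U - 1) k"
      using majorized_uptoD[OF p, of k] p0 U0
      by (cases "k = 0") (simp_all add: abs_mult field_simps)
  qed
  have "majorized_upto n (fps_binomial (- \<alpha>)) ?B"
    by (simp add: majorized_upto_def)
  from majorized_upto_compose[OF this u]
  have 1: "majorized_upto n (fps_binomial (- \<alpha>) oo ?u) (?B oo (U - 1))" .
  have "?B oo (U - 1) = fps_binomial (- \<alpha>) oo (- (U - 1))"
  proof (rule fps_ext)
    fix k
    have "(- (U - 1)) ^ i = (-1) ^ i * (U - 1) ^ i" for i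
      by (rule power_minus)
    moreover have "fps_nth ((-1) ^ i * (U - 1) ^ i) k = (-1) ^ i * fps_nth ((U - 1) ^ i) k" for i
      by (cases "even i") simp_all
    ultimately show "fps_nth (?B oo (U - 1)) k = fps_nth (fps_binomial (- \<alpha>) oo (- (U - 1))) k"
      by (auto simp: fps_compose_nth abs_gbinomial_minus[OF \<open>\<alpha> \<ge> 0\<close>] intro!: sum.cong)
  qed
  also have "\<dots> = fps_powr (2 - U) (- \<alpha>)"
    using U0 by (simp add: fps_powr_def)
  finally have "majorized_upto n (fps_binomial (- \<alpha>) oo ?u) (fps_powr (2 - U) (- \<alpha>))"
    using 1 by simp
  then show ?thesis
    unfolding fps_powr_def[of p] by (intro majorized_upto_mult majorized_upto_const) simp_all
qed

text \<open>
  The previous lemma for the constant series \<open>p = 1\<close>. It shows in particular that the coefficients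
  of the right-hand side are nonnegative.
\<close>

lemma one_majorized_upto_powr_minus:
  assumes "\<alpha> \<ge> 0" "fps_nth U 0 = 1" "\<And>k. fps_nth U k \<ge> 0"
  shows "majorized_upto n (1 :: real fps) (fps_powr (2 - U) (- \<alpha>))"
proof -
  have "majorized_upto n (1 :: real fps) U"
    using assms by (simp add: majorized_upto_def)
  moreover have "fps_powr 1 (- \<alpha>) = 1"
    by (simp add: fps_powr_def)
  ultimately show ?thesis
    using majorized_upto_powr_minus[of \<alpha> 1 U n] assms by simp
qed

text \<open>
  Turns every quotient in the equations of motion into a product with a power of
  \<open>1 / \<parallel>f\<parallel> = (f \<bullet> f)\<close> to the power \<open>- 1 / 2\<close>, to which the rules for majorants apply.
\<close>

lemma fps_divide_norm_power:
  assumes "fps_nth f 0 \<noteq> 0"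
  shows "p / fps_norm f ^ k = p * fps_powr (fps_inner f f) (- 1 / 2) ^ k"
proof -
  have "fps_nth (fps_inner f f) 0 > 0"
    using assms by (simp add: fps_inner_def)
  then have "inverse (fps_norm f) = fps_powr (fps_inner f f) (- 1 / 2)"
    using fps_powr_minus[of "fps_inner f f" "1 / 2"] by (simp add: fps_norm_def)
  then show ?thesis
    using assms
    by (simp add: fps_divide_unit fps_nth_power_0 fps_norm_nth_0 fps_inverse_power)
qed

lemma fps_inverse_norm_nth_0:
  assumes "fps_nth f 0 \<noteq> 0"
  shows "fps_nth (fps_powr (fps_inner f f) (- 1 / 2)) 0 = 1 / norm (fps_nth f 0)"
proof -
  have "fps_nth (fps_inner f f) 0 = (norm (fps_nth f 0))\<^sup>2"
    by (simp add: fps_inner_def power2_norm_eq_inner)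
  then show ?thesis
    using assms by (simp add: fps_powr_nth_0 powr_minus_divide powr_half_sqrt)
qed

lemma majorized_upto_inverse_norm:
  assumes f0: "fps_nth f 0 \<noteq> 0" and X0: "fps_nth X 0 = 1"
    and f: "majorized_upto n f (fps_const (norm (fps_nth f 0)) * X)"
  shows "majorized_upto n (fps_powr (fps_inner f f) (- 1 / 2))
    (fps_const (1 / norm (fps_nth f 0)) * fps_powr (2 - X\<^sup>2) (- 1 / 2))"
proof -
  let ?d = "norm (fps_nth f 0)"
  have c: "fps_nth (fps_inner f f) 0 = ?d\<^sup>2"
    by (simp add: fps_inner_def power2_norm_eq_inner)
  have "fps_const ?d * X * (fps_const ?d * X) = fps_const (?d\<^sup>2) * X\<^sup>2"
    by (simp add: power2_eq_square mult_ac flip: fps_const_mult)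
  then have "majorized_upto n (fps_inner f f) (fps_const (?d\<^sup>2) * X\<^sup>2)"
    using majorized_upto_inner[OF f f] by simp
  then show ?thesis
    using majorized_upto_powr_minus[of "1 / 2" "fps_inner f f" "X\<^sup>2" n] f0 X0
      fps_inverse_norm_nth_0[OF f0]
    by (simp add: c fps_nth_power_0 fps_powr_nth_0)
qed

lemma majorized_upto_inverse_norm_power:
  assumes "fps_nth f 0 \<noteq> 0" "fps_nth X 0 = 1"
    and "majorized_upto n f (fps_const (norm (fps_nth f 0)) * X)"
  shows "majorized_upto n (fps_powr (fps_inner f f) (- 1 / 2) ^ k)
    (fps_const (1 / norm (fps_nth f 0) ^ k) * fps_powr (2 - X\<^sup>2) (- 1 / 2) ^ k)"
  using majorized_upto_power[OF majorized_upto_inverse_norm[OF assms], of k]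
  by (simp add: power_mult_distrib fps_const_power power_one_over del: power_divide)

lemma sum_fps_const_mult:
  "(\<Sum>i\<in>A. fps_const (c i) * F) = fps_const (\<Sum>i\<in>A. c i :: real) * F"
  by (rule fps_ext) (simp add: fps_sum_nth sum_distrib_right)

section \<open>The initial configuration\<close>

text \<open>
  One step of the induction: the bounds are assumed up to order \<open>n\<close>. They are stated for ordered
  pairs \<open>i \<noteq> j\<close>, since \<open>g\<^sub>i\<close> involves \<open>Q\<^sub>j - Q\<^sub>i\<close> for \<open>j\<close> on both sides of \<open>i\<close>.
\<close>

locale nbody_majorized =
  fixes N :: nat and G :: real and m :: "nat \<Rightarrow> real"
    and q0 v0 :: "nat \<Rightarrow> real^3"
    and Q V :: "nat \<Rightarrow> (real^3) fps"
    and \<xi> \<zeta> :: "real fps"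
    and n :: nat
  assumes N: "N \<ge> 2"
    and m_pos: "i \<in> {1..N} \<Longrightarrow> m i > 0"
    and G_pos: "G > 0"
    and q0_neq: "i \<in> {1..N} \<Longrightarrow> j \<in> {1..N} \<Longrightarrow> i \<noteq> j \<Longrightarrow> q0 i \<noteq> q0 j"
    and Q_nth_0: "i \<in> {1..N} \<Longrightarrow> fps_nth (Q i) 0 = q0 i"
    and V_nth_0: "i \<in> {1..N} \<Longrightarrow> fps_nth (V i) 0 = v0 i"
    and \<xi>_nth_0: "fps_nth \<xi> 0 = 1" and \<zeta>_nth_0: "fps_nth \<zeta> 0 = 0"
    and \<xi>_nonneg: "fps_nth \<xi> k \<ge> 0" and \<zeta>_nonneg: "fps_nth \<zeta> k \<ge> 0"
    and Q_majorized: "i \<in> {1..N} \<Longrightarrow> j \<in> {1..N} \<Longrightarrow> i \<noteq> j \<Longrightarrow>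
      majorized_upto n (Q i - Q j) (fps_const (norm (q0 i - q0 j)) * \<xi>)"
    and V_majorized: "i \<in> {1..N} \<Longrightarrow> j \<in> {1..N} \<Longrightarrow> i \<noteq> j \<Longrightarrow>
      majorized_upto n (V i - V j) (fps_const (norm (v0 i - v0 j)) +
        fps_const (nbody_s N G m q0 v0 * nbody_M N G m q0 i j) * \<zeta>)"
begin

abbreviation (input) s where "s \<equiv> nbody_s N G m q0 v0"
abbreviation (input) K where "K \<equiv> nbody_K N G m q0"
abbreviation (input) M where "M \<equiv> nbody_M N G m q0"
abbreviation (input) d where "d i j \<equiv> norm (q0 i - q0 j)"
abbreviation (input) w where "w i j \<equiv> norm (v0 i - v0 j)"
text \<open>The series \<open>1 / \<parallel>Q\<^sub>i - Q\<^sub>j\<parallel>\<close>.\<close>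

abbreviation (input) r where "r i j \<equiv> fps_powr (fps_inner (Q i - Q j) (Q i - Q j)) (- 1 / 2)"

definition \<rho> :: "real fps" where "\<rho> = fps_powr (2 - \<xi>\<^sup>2) (- 1 / 2)"
definition \<sigma> :: "real fps" where "\<sigma> = fps_powr (2 - chi \<xi> \<zeta>) (- 1 / 2)"
definition S :: real where
  "S = (\<Sum>i\<in>{1..N}. \<Sum>j\<in>{i<..N}. (w i j)\<^sup>2 / (d i j)\<^sup>2 + M i j / d i j)"

lemma d_pos: "i \<in> {1..N} \<Longrightarrow> j \<in> {1..N} \<Longrightarrow> i \<noteq> j \<Longrightarrow> d i j > 0"
  using q0_neq by simp

lemma K_pos:
  assumes "i \<in> {1..N}"
  shows "K i > 0"
proof -
  have "1 \<in> {1..N} - {i} \<or> 2 \<in> {1..N} - {i}"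
    using N by auto
  then have "{1..N} - {i} \<noteq> {}"
    by blast
  moreover have "G * m j / (d i j)\<^sup>2 > 0" if "j \<in> {1..N} - {i}" for j
    using that assms m_pos[of j] G_pos d_pos[of i j] by simp
  ultimately show ?thesis
    unfolding nbody_K_def by (intro sum_pos) simp_all
qed

lemma M_pos: "i \<in> {1..N} \<Longrightarrow> j \<in> {1..N} \<Longrightarrow> M i j > 0"
  by (simp add: nbody_M_def K_pos add_pos_pos)

lemma M_commute: "M i j = M j i"
  by (simp add: nbody_M_def)

lemma pair_term_pos:
  "i \<in> {1..N} \<Longrightarrow> j \<in> {1..N} \<Longrightarrow> i \<noteq> j \<Longrightarrow> (w i j)\<^sup>2 / (d i j)\<^sup>2 + M i j / d i j > 0"
  by (intro add_nonneg_pos divide_pos_pos d_pos M_pos) auto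

lemma pair_term_le_S:
  assumes "i \<in> {1..N}" "j \<in> {i<..N}"
  shows "(w i j)\<^sup>2 / (d i j)\<^sup>2 + M i j / d i j \<le> S"
proof -
  let ?t = "\<lambda>i j. (w i j)\<^sup>2 / (d i j)\<^sup>2 + M i j / d i j"
  have pos: "?t i j \<ge> 0" if "i \<in> {1..N}" "j \<in> {i<..N}" for i j
    using that by (intro less_imp_le[OF pair_term_pos]) auto
  have "?t i j \<le> (\<Sum>j\<in>{i<..N}. ?t i j)"
    using assms pos[OF assms(1)] by (intro member_le_sum[where f = "?t i"]) auto
  also have "\<dots> \<le> S"
    unfolding S_def using assms(1) pos
    by (intro member_le_sum[where f = "\<lambda>i. \<Sum>j\<in>{i<..N}. ?t i j"] sum_nonneg) auto
  finally show ?thesis .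
qed

lemma S_pos: "S > 0"
  using pair_term_le_S[of 1 2] pair_term_pos[of 1 2] N by simp

lemma s_eq: "s = S powr (- (1 / 2))"
  by (simp add: nbody_s_def S_def sum.distrib)

lemma s_pos: "s > 0"
  using S_pos by (simp add: s_eq)

lemma s_square: "s\<^sup>2 = 1 / S"
  using S_pos by (simp add: s_eq powr_minus_divide powr_half_sqrt power_divide)

text \<open>
  The purpose of the time renormalization: a single pair contributes at most the whole sum
  \<open>S = 1 / s\<^sup>2\<close>, so in the new time the relative velocity and the relative acceleration are bounded
  by the distance.
\<close>

lemma pair_bounds:
  assumes "i \<in> {1..N}" "j \<in> {1..N}" "i \<noteq> j"
  shows "s * w i j \<le> d i j" and "s\<^sup>2 * M i j \<le> d i j"
proof -
  have le: "(w i j)\<^sup>2 / (d i j)\<^sup>2 + M i j / d i j \<le> S"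
  proof (cases "i < j")
    case True
    then show ?thesis using assms by (intro pair_term_le_S) auto
  next
    case False
    then have "(w j i)\<^sup>2 / (d j i)\<^sup>2 + M j i / d j i \<le> S"
      using assms by (intro pair_term_le_S) auto
    then show ?thesis
      by (simp only: norm_minus_commute[of _ "q0 i"] norm_minus_commute[of _ "v0 i"] M_commute[of j])
  qed
  have d: "d i j > 0" using assms by (rule d_pos)
  have "0 < M i j / d i j" "0 \<le> (w i j)\<^sup>2 / (d i j)\<^sup>2"
    using d M_pos[OF assms(1,2)] by simp_all
  with le have 1: "M i j / d i j \<le> S" and 2: "(w i j)\<^sup>2 / (d i j)\<^sup>2 \<le> S"
    by linarith+
  from 1 show "s\<^sup>2 * M i j \<le> d i j"
    using d S_pos by (simp add: s_square pos_divide_le_eq mult.commute)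
  from 2 have "(s * w i j)\<^sup>2 \<le> (d i j)\<^sup>2"
    using d S_pos by (simp add: s_square power_mult_distrib pos_divide_le_eq mult.commute)
  then show "s * w i j \<le> d i j"
    by (rule power2_le_imp_le) simp
qed

section \<open>The series of the majorant system\<close>

text \<open>All powers of \<open>2 - \<xi>\<^sup>2\<close> that occur are powers of \<open>\<rho>\<close>.\<close>

lemma chi_eq: "chi \<xi> \<zeta> = \<rho>\<^sup>2 * (2 * \<zeta> + \<zeta>\<^sup>2 + \<rho>)"
proof -
  have "fps_nth (2 - \<xi>\<^sup>2) 0 > 0"
    by (simp add: \<xi>_nth_0 fps_nth_power_0)
  then have "inverse (2 - \<xi>\<^sup>2) = \<rho>\<^sup>2"
    using fps_powr_power[of "2 - \<xi>\<^sup>2" "- 1 / 2" 2] fps_powr_minus[of "2 - \<xi>\<^sup>2" 1]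
    by (simp add: \<rho>_def fps_powr_one)
  then show ?thesis by (simp add: chi_def \<rho>_def)
qed

lemma divide_powr_eq: "p / fps_powr (2 - \<xi>\<^sup>2) (3 / 2) = p * \<rho> ^ 3"
proof -
  have "fps_nth (2 - \<xi>\<^sup>2) 0 > 0"
    by (simp add: \<xi>_nth_0 fps_nth_power_0)
  then show ?thesis
    using fps_powr_power[of "2 - \<xi>\<^sup>2" "- 1 / 2" 3] fps_powr_minus[of "2 - \<xi>\<^sup>2" "3 / 2"]
    by (simp add: \<rho>_def fps_divide_unit fps_powr_nth_0)
qed

lemma \<rho>_nth_0: "fps_nth \<rho> 0 = 1"
  by (simp add: \<rho>_def fps_powr_nth_0 \<xi>_nth_0 fps_nth_power_0)

lemma chi_nth_0: "fps_nth (chi \<xi> \<zeta>) 0 = 1"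
  by (simp add: chi_eq \<rho>_nth_0 \<zeta>_nth_0 fps_nth_power_0)

lemma one_majorized_\<rho>: "majorized_upto k (1 :: real fps) \<rho>"
  using one_majorized_upto_powr_minus[of "1 / 2" "\<xi>\<^sup>2"]
  by (simp add: \<rho>_def \<xi>_nth_0 fps_nth_power_0 power2_eq_square fps_mult_nonneg \<xi>_nonneg)

lemma \<rho>_nonneg: "fps_nth \<rho> k \<ge> 0"
  using majorized_uptoD[OF one_majorized_\<rho>, of k k] by (simp split: if_splits)

lemma \<rho>_square_nonneg: "fps_nth (\<rho>\<^sup>2) k \<ge> 0"
  by (simp add: power2_eq_square fps_mult_nonneg \<rho>_nonneg)

text \<open>
  The term \<open>\<rho>\<^sup>2 w\<^sup>2 / d\<^sup>2\<close> coming from the initial velocities has no counterpart in \<open>\<chi>\<close>; it is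
  absorbed into the summand \<open>\<rho>\<^sup>3\<close> of \<open>\<chi>\<close>.
\<close>

lemma \<rho>_square_le_cube: "fps_nth (\<rho>\<^sup>2) k \<le> fps_nth (\<rho> ^ 3) k"
proof -
  have "majorized_upto k (\<rho>\<^sup>2) (\<rho>\<^sup>2)"
    by (simp add: majorized_upto_def \<rho>_square_nonneg)
  from majorized_uptoD[OF majorized_upto_mult[OF this one_majorized_\<rho>], of k]
  show ?thesis by (simp add: power2_eq_square power3_eq_cube)
qed

lemma chi_nonneg: "fps_nth (chi \<xi> \<zeta>) k \<ge> 0"
  unfolding chi_eq
  by (intro fps_mult_nonneg \<rho>_square_nonneg)
    (simp add: power2_eq_square numeral_fps_const fps_mult_nonneg \<zeta>_nonneg \<rho>_nonneg)

lemma \<sigma>_nonneg: "fps_nth \<sigma> k \<ge> 0"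
proof -
  have "majorized_upto k (1 :: real fps) \<sigma>"
    using one_majorized_upto_powr_minus[of "1 / 2" "chi \<xi> \<zeta>" k]
    by (simp add: \<sigma>_def chi_nth_0 chi_nonneg)
  from majorized_uptoD[OF this, of k] show ?thesis by (simp split: if_splits)
qed

section \<open>Majorants of the right-hand sides\<close>

lemma inverse_distance_majorized:
  assumes "i \<in> {1..N}" "j \<in> {1..N}" "i \<noteq> j"
  shows "majorized_upto n (r i j ^ k) (fps_const (1 / d i j ^ k) * \<rho> ^ k)"
  using majorized_upto_inverse_norm_power[of "Q i - Q j" \<xi> n k] Q_majorized[OF assms]
    q0_neq[OF assms] assms
  by (simp add: Q_nth_0 \<xi>_nth_0 \<rho>_def)

lemma divide_distance:
  assumes "i \<in> {1..N}" "j \<in> {1..N}" "i \<noteq> j"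
  shows "p / fps_norm (Q i - Q j) ^ k = p * r i j ^ k"
  using q0_neq[OF assms] assms by (intro fps_divide_norm_power) (simp add: Q_nth_0)

lemma K_majorized:
  assumes "i \<in> {1..N}"
  shows "majorized_upto n (fps_nbody_K N G m Q i) (fps_const (K i) * \<rho>\<^sup>2)"
proof -
  have "majorized_upto n (fps_const (G * m j) / fps_norm (Q i - Q j) ^ 2)
      (fps_const (G * m j / (d i j)\<^sup>2) * \<rho>\<^sup>2)" if "j \<in> {1..N} - {i}" for j
  proof -
    have "majorized_upto n (fps_const (G * m j) * r i j ^ 2)
        (fps_const (G * m j) * (fps_const (1 / (d i j)\<^sup>2) * \<rho>\<^sup>2))"
      using that assms m_pos[of j] G_pos
      by (intro majorized_upto_mult majorized_upto_const inverse_distance_majorized) auto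
    then show ?thesis
      using that assms by (simp add: divide_distance mult.assoc[symmetric])
  qed
  from majorized_upto_sum[OF this] show ?thesis
    unfolding fps_nbody_K_def nbody_K_def by (simp only: sum_fps_const_mult)
qed

text \<open>The factor \<open>d \<xi>\<close> of \<open>Q\<^sub>j - Q\<^sub>i\<close> cancels one power of \<open>1 / d\<close>, which turns \<open>g\<^sub>i\<close> into \<open>K\<^sub>i\<close>.\<close>

lemma g_majorized:
  assumes "i \<in> {1..N}"
  shows "majorized_upto n (fps_nbody_g N G m Q i) (fps_const (K i) * (\<xi> * \<rho> ^ 3))"
proof -
  have "majorized_upto n (fps_scale (fps_const (G * m j) / fps_norm (Q i - Q j) ^ 3) (Q j - Q i))
      (fps_const (G * m j / (d i j)\<^sup>2) * (\<xi> * \<rho> ^ 3))" if j: "j \<in> {1..N} - {i}" for j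
  proof -
    have d: "d i j > 0" using j assms by (intro d_pos) auto
    have "majorized_upto n (fps_scale (fps_const (G * m j) * r i j ^ 3) (Q j - Q i))
        (fps_const (G * m j) * (fps_const (1 / d i j ^ 3) * \<rho> ^ 3) * (fps_const (d j i) * \<xi>))"
      using j assms m_pos[of j] G_pos
      by (intro majorized_upto_scale majorized_upto_mult majorized_upto_const
          inverse_distance_majorized Q_majorized) auto
    also have "fps_const (G * m j) * (fps_const (1 / d i j ^ 3) * \<rho> ^ 3) * (fps_const (d j i) * \<xi>)
        = fps_const (G * m j * (1 / d i j ^ 3) * d i j) * (\<xi> * \<rho> ^ 3)"
      by (simp only: fps_const_mult[symmetric] norm_minus_commute[of "q0 j"] mult_ac)
    also have "G * m j * (1 / d i j ^ 3) * d i j = G * m j / (d i j)\<^sup>2"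
      using d by (simp add: field_simps power2_eq_square power3_eq_cube)
    finally show ?thesis
      using j assms by (simp add: divide_distance)
  qed
  from majorized_upto_sum[OF this] show ?thesis
    unfolding fps_nbody_g_def nbody_K_def by (simp only: sum_fps_const_mult)
qed

lemma g_diff_majorized:
  assumes "i \<in> {1..N}" "j \<in> {1..N}"
  shows "majorized_upto n (fps_nbody_g N G m Q i - fps_nbody_g N G m Q j)
    (fps_const (M i j) * (\<xi> * \<rho> ^ 3))"
  using majorized_upto_diff[OF g_majorized[OF assms(1)] g_majorized[OF assms(2)]]
  by (simp add: nbody_M_def distrib_right flip: fps_const_add)

text \<open>
  Expand the square in \<open>\<rho>\<^sup>2 (w + s M \<zeta>)\<^sup>2 / d\<^sup>2 + M \<rho>\<^sup>3 / d\<close> and put \<open>A = w\<^sup>2 / d\<^sup>2\<close>, \<open>B = M / d\<close>,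
  \<open>a = s w / d\<close>, \<open>b = s\<^sup>2 M / d\<close>. The result is
  \<open>A \<rho>\<^sup>2 + 2 a B \<rho>\<^sup>2 \<zeta> + b B \<rho>\<^sup>2 \<zeta>\<^sup>2 + B \<rho>\<^sup>3\<close>, and \<open>a, b \<le> 1\<close> allow a comparison with
  \<open>(A + B) (2 \<rho>\<^sup>2 \<zeta> + \<rho>\<^sup>2 \<zeta>\<^sup>2 + \<rho>\<^sup>3)\<close> summand by summand.
\<close>

lemma pair_term_majorized:
  assumes ij: "i \<in> {1..N}" "j \<in> {1..N}" "i \<noteq> j"
  shows "majorized_upto n
    (fps_inner (V i - V j) (V i - V j) / fps_norm (Q i - Q j) ^ 2 +
      fps_nbody_M N G m Q i j / fps_norm (Q i - Q j))
    (fps_const ((w i j)\<^sup>2 / (d i j)\<^sup>2 + M i j / d i j) * chi \<xi> \<zeta>)" (is "majorized_upto n ?P _")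
proof -
  let ?w = "w i j" and ?d = "d i j" and ?M = "M i j"
  let ?W = "fps_const ?w + fps_const (s * ?M) * \<zeta>"
  let ?y = "\<rho>\<^sup>2 * \<zeta>" and ?z = "\<rho>\<^sup>2 * \<zeta>\<^sup>2"
  let ?F = "?W * ?W * (fps_const (1 / ?d\<^sup>2) * \<rho>\<^sup>2) +
      (fps_const (K i) * \<rho>\<^sup>2 + fps_const (K j) * \<rho>\<^sup>2) * (fps_const (1 / ?d ^ 1) * \<rho> ^ 1)"
  have eq: "?P = fps_inner (V i - V j) (V i - V j) * r i j ^ 2 +
      (fps_nbody_K N G m Q i + fps_nbody_K N G m Q j) * r i j ^ 1"
    using divide_distance[OF ij, of _ 2] divide_distance[OF ij, of _ 1]
    by (simp add: fps_nbody_M_def)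
  have maj: "majorized_upto n ?P ?F"
    unfolding eq using ij
    by (intro majorized_upto_add majorized_upto_mult majorized_upto_inner V_majorized
        K_majorized inverse_distance_majorized)
  have d: "?d > 0" using ij by (rule d_pos)
  have M: "?M > 0" using ij by (simp add: M_pos)
  have "?F = fps_const (1 / ?d\<^sup>2) * (?W * ?W * \<rho>\<^sup>2) + fps_const (1 / ?d) * (fps_const ?M * \<rho> ^ 3)"
    by (simp add: nbody_M_def algebra_simps power2_eq_square power3_eq_cube flip: fps_const_add)
  also have "?W * ?W * \<rho>\<^sup>2 = fps_const (?w\<^sup>2) * \<rho>\<^sup>2 +
      fps_const (2 * ?w * (s * ?M)) * ?y + fps_const ((s * ?M)\<^sup>2) * ?z"
    by (simp add: algebra_simps power2_eq_square numeral_fps_const flip: fps_const_mult)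
  finally have F_nth: "fps_nth ?F k = 1 / ?d\<^sup>2 * (?w\<^sup>2 * fps_nth (\<rho>\<^sup>2) k +
      2 * ?w * (s * ?M) * fps_nth ?y k + (s * ?M)\<^sup>2 * fps_nth ?z k) +
      1 / ?d * (?M * fps_nth (\<rho> ^ 3) k)" for k
    by simp
  have chi_nth: "fps_nth (chi \<xi> \<zeta>) k = 2 * fps_nth ?y k + fps_nth ?z k + fps_nth (\<rho> ^ 3) k" for k
  proof -
    have "chi \<xi> \<zeta> = fps_const 2 * ?y + ?z + \<rho> ^ 3"
      by (simp add: chi_eq algebra_simps power2_eq_square power3_eq_cube flip: numeral_fps_const)
    then show ?thesis by simp
  qed
  define a where "a = s * ?w / ?d"
  define b where "b = s\<^sup>2 * ?M / ?d"
  define A where "A = ?w\<^sup>2 / ?d\<^sup>2"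
  define B where "B = ?M / ?d"
  have nonneg: "A \<ge> 0" "B \<ge> 0" "a \<ge> 0" "b \<ge> 0"
    using d M s_pos by (simp_all add: A_def B_def a_def b_def)
  have a1: "a \<le> 1" and b1: "b \<le> 1"
    using pair_bounds[OF ij] d by (simp_all add: a_def b_def)
  have "majorized_upto n ?F (fps_const (A + B) * chi \<xi> \<zeta>)"
    unfolding majorized_upto_def
  proof (intro allI impI)
    fix k
    let ?x = "fps_nth (\<rho>\<^sup>2) k" and ?t = "fps_nth (\<rho> ^ 3) k"
    have x: "0 \<le> ?x" "?x \<le> ?t" by (fact \<rho>_square_nonneg \<rho>_square_le_cube)+
    have y: "0 \<le> fps_nth ?y k"
      by (intro fps_mult_nonneg \<rho>_square_nonneg \<zeta>_nonneg)
    have z: "0 \<le> fps_nth ?z k"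
      by (intro fps_mult_nonneg \<rho>_square_nonneg) (simp add: power2_eq_square fps_mult_nonneg \<zeta>_nonneg)
    have F: "fps_nth ?F k = A * ?x + 2 * (a * B) * fps_nth ?y k + b * B * fps_nth ?z k + B * ?t"
      unfolding F_nth A_def B_def a_def b_def using d
      by (simp add: field_simps power2_eq_square)
    have "A * ?x \<le> A * ?t" using x nonneg by (intro mult_left_mono)
    moreover have "a * B * fps_nth ?y k \<le> (A + B) * fps_nth ?y k"
      using nonneg a1 y mult_right_mono[OF a1, of B] by (intro mult_right_mono) simp_all
    moreover have "b * B * fps_nth ?z k \<le> (A + B) * fps_nth ?z k"
      using nonneg b1 z mult_right_mono[OF b1, of B] by (intro mult_right_mono) simp_all
    moreover have "fps_nth ?F k \<ge> 0"
      unfolding F using x y z nonneg by (intro add_nonneg_nonneg mult_nonneg_nonneg) auto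
    ultimately show "norm (fps_nth ?F k) \<le> fps_nth (fps_const (A + B) * chi \<xi> \<zeta>) k"
      unfolding F by (simp add: chi_nth algebra_simps)
  qed
  from majorized_upto_trans[OF maj this] show ?thesis
    by (simp add: A_def B_def)
qed

text \<open>
  Summing the bounds on the pairs gives exactly \<open>S \<chi>\<close>, where \<open>S\<close> is the constant term of the sum,
  as required to take the power \<open>-1/2\<close>.
\<close>

lemma s_majorized: "majorized_upto n (fps_nbody_s N G m Q V) (fps_const s * \<sigma>)"
proof -
  define P where "P = (\<Sum>i\<in>{1..N}. \<Sum>j\<in>{i<..N}.
    fps_inner (V i - V j) (V i - V j) / fps_norm (Q i - Q j) ^ 2 +
    fps_nbody_M N G m Q i j / fps_norm (Q i - Q j))"
  have P0: "fps_nth P 0 = S"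
    unfolding P_def S_def fps_sum_nth
  proof (intro sum.cong refl)
    fix i j assume "i \<in> {1..N}" "j \<in> {i<..N}"
    then have ij: "i \<in> {1..N}" "j \<in> {1..N}" "i \<noteq> j" by auto
    have K: "fps_nth (fps_nbody_K N G m Q i) 0 = K i" if "i \<in> {1..N}" for i
      using that q0_neq[of i]
      by (subst fps_nbody_K_nth_0) (auto simp: Q_nth_0 nbody_K_def intro!: sum.cong)
    have r: "fps_nth (r i j) 0 = 1 / d i j"
      using fps_inverse_norm_nth_0[of "Q i - Q j"] ij q0_neq[OF ij] by (simp add: Q_nth_0)
    show "fps_nth (fps_inner (V i - V j) (V i - V j) / fps_norm (Q i - Q j) ^ 2 +
        fps_nbody_M N G m Q i j / fps_norm (Q i - Q j)) 0 = (w i j)\<^sup>2 / (d i j)\<^sup>2 + M i j / d i j"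
      using divide_distance[OF ij, of _ 2] divide_distance[OF ij, of _ 1] ij r
      by (simp add: fps_nbody_M_def nbody_M_def K fps_inner_def V_nth_0 power2_norm_eq_inner
          fps_nth_power_0 power_divide)
  qed
  have "majorized_upto n P (fps_const S * chi \<xi> \<zeta>)"
    unfolding P_def S_def sum_fps_const_mult[symmetric]
    by (intro majorized_upto_sum pair_term_majorized) auto
  then have "majorized_upto n (fps_powr P (- (1 / 2)))
      (fps_const (S powr (- (1 / 2))) * fps_powr (2 - chi \<xi> \<zeta>) (- (1 / 2)))"
    using majorized_upto_powr_minus[of "1 / 2" P "chi \<xi> \<zeta>" n] S_pos
    by (simp add: P0 chi_nth_0)
  then show ?thesis
    by (simp add: s_eq \<sigma>_def fps_nbody_s_def P_def sum.distrib)
qed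

lemma Q_rhs_majorized:
  assumes ij: "i \<in> {1..N}" "j \<in> {1..N}" "i \<noteq> j"
  shows "majorized_upto n (fps_scale (fps_nbody_s N G m Q V) (V i - V j))
    (fps_const (d i j) * ((1 + \<zeta>) * \<sigma>))"
proof (rule majorized_upto_trans)
  let ?F = "fps_const s * \<sigma> * (fps_const (w i j) + fps_const (s * M i j) * \<zeta>)"
  show "majorized_upto n (fps_scale (fps_nbody_s N G m Q V) (V i - V j)) ?F"
    using ij by (intro majorized_upto_scale s_majorized V_majorized)
  have F: "?F = fps_const (s * w i j) * \<sigma> + fps_const (s\<^sup>2 * M i j) * (\<zeta> * \<sigma>)"
    by (simp add: algebra_simps power2_eq_square flip: fps_const_mult)
  show "majorized_upto n ?F (fps_const (d i j) * ((1 + \<zeta>) * \<sigma>))"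
    unfolding majorized_upto_def F
  proof (intro allI impI)
    fix k
    let ?a = "fps_nth \<sigma> k" and ?b = "fps_nth (\<zeta> * \<sigma>) k"
    have a: "?a \<ge> 0" and b: "?b \<ge> 0"
      by (simp_all add: \<sigma>_nonneg fps_mult_nonneg \<zeta>_nonneg)
    have "s * w i j * ?a \<le> d i j * ?a" "s\<^sup>2 * M i j * ?b \<le> d i j * ?b"
      using pair_bounds[OF ij] a b by (auto intro: mult_right_mono)
    moreover have "s * w i j * ?a \<ge> 0" "s\<^sup>2 * M i j * ?b \<ge> 0"
      using s_pos M_pos[OF ij(1,2)] a b by (simp_all add: less_imp_le)
    ultimately show "norm (fps_nth (fps_const (s * w i j) * \<sigma> + fps_const (s\<^sup>2 * M i j) * (\<zeta> * \<sigma>)) k)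
        \<le> fps_nth (fps_const (d i j) * ((1 + \<zeta>) * \<sigma>)) k"
      by (simp add: distrib_left distrib_right)
  qed
qed

lemma V_rhs_majorized:
  assumes "i \<in> {1..N}" "j \<in> {1..N}"
  shows "majorized_upto n
    (fps_scale (fps_nbody_s N G m Q V) (fps_nbody_g N G m Q i - fps_nbody_g N G m Q j))
    (fps_const (s * M i j) * (\<xi> * \<sigma> * \<rho> ^ 3))"
  using majorized_upto_scale[OF s_majorized g_diff_majorized[OF assms]]
  by (simp add: mult_ac flip: fps_const_mult)

end

section \<open>Comparison of the solutions\<close>

lemma fps_vderiv_diff: "fps_vderiv (f - g) = fps_vderiv f - fps_vderiv g"
  by (rule fps_ext) (simp add: fps_vderiv_def scaleR_diff_right)

lemma fps_scale_diff: "fps_scale a (f - g) = fps_scale a f - fps_scale a g"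
  by (rule fps_ext) (simp add: fps_scale_def scaleR_diff_right sum_subtractf)

theorem theorem2:
  fixes N :: nat and G :: real and m :: "nat \<Rightarrow> real"
    and q0 v0 :: "nat \<Rightarrow> real^3"
    and Q V :: "nat \<Rightarrow> (real^3) fps"
    and \<xi> \<zeta> :: "real fps"
  assumes "N \<ge> 2"
    and "\<And>i. i \<in> {1..N} \<Longrightarrow> m i > 0"
    and "G > 0"
    and "\<And>i j. 1 \<le> i \<Longrightarrow> i < j \<Longrightarrow> j \<le> N \<Longrightarrow> q0 i \<noteq> q0 j"
    and "nbody_solution N G m q0 v0 Q V"
    and "\<And>k. fps_nth \<xi> k \<ge> 0" and "\<And>k. fps_nth \<zeta> k \<ge> 0"
    and "majorant_solution \<xi> \<zeta>"
  shows "\<And>i j. 1 \<le> i \<Longrightarrow> i < j \<Longrightarrow> j \<le> N \<Longrightarrow>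
    Q i - Q j \<unlhd> fps_const (norm (q0 i - q0 j)) * \<xi> \<and>
    V i - V j \<unlhd> fps_const (norm (v0 i - v0 j)) +
      fps_const (nbody_s N G m q0 v0 * nbody_M N G m q0 i j) * \<zeta>"
proof -
  let ?X = "\<lambda>i j. fps_const (norm (q0 i - q0 j)) * \<xi>"
  let ?Z = "\<lambda>i j. fps_const (norm (v0 i - v0 j)) +
      fps_const (nbody_s N G m q0 v0 * nbody_M N G m q0 i j) * \<zeta>"
  note sol = assms(5)[unfolded nbody_solution_def, rule_format]
  note maj = assms(8)[unfolded majorant_solution_def]
  have q0_neq: "q0 i \<noteq> q0 j" if "i \<in> {1..N}" "j \<in> {1..N}" "i \<noteq> j" for i j
    using assms(4)[of i j] assms(4)[of j i] that by (cases "i < j") auto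
  have Q0: "norm (fps_nth (Q i - Q j) 0) \<le> fps_nth (?X i j) 0"
    if "i \<in> {1..N}" "j \<in> {1..N}" for i j
    using sol that maj by simp
  have V0: "norm (fps_nth (V i - V j) 0) \<le> fps_nth (?Z i j) 0"
    if "i \<in> {1..N}" "j \<in> {1..N}" for i j
    using sol that maj by simp
  have main: "\<forall>i\<in>{1..N}. \<forall>j\<in>{1..N}. i \<noteq> j \<longrightarrow>
      majorized_upto n (Q i - Q j) (?X i j) \<and> majorized_upto n (V i - V j) (?Z i j)" for n
  proof (induction n)
    case 0
    show ?case using Q0 V0 unfolding majorized_upto_def by blast
  next
    case (Suc n)
    interpret nbody_majorized N G m q0 v0 Q V \<xi> \<zeta> n
      using assms(1-3,6,7) q0_neq sol maj Suc.IH by unfold_locales auto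
    show ?case
    proof (intro ballI impI conjI majorized_upto_integrate)
      fix i j assume ij: "i \<in> {1..N}" "j \<in> {1..N}" "i \<noteq> j"
      show "norm (fps_nth (Q i - Q j) 0) \<le> fps_nth (?X i j) 0"
        "norm (fps_nth (V i - V j) 0) \<le> fps_nth (?Z i j) 0"
        using Q0 V0 ij by auto
      show "majorized_upto n (fps_vderiv (Q i - Q j)) (fps_deriv (?X i j))"
        using Q_rhs_majorized[OF ij] sol ij maj
        by (simp add: fps_vderiv_diff fps_scale_diff \<sigma>_def)
      show "majorized_upto n (fps_vderiv (V i - V j)) (fps_deriv (?Z i j))"
        using V_rhs_majorized[OF ij(1,2)] sol ij maj
        by (simp add: fps_vderiv_diff fps_scale_diff divide_powr_eq \<sigma>_def)
    qed
  qed
  show "Q i - Q j \<unlhd> ?X i j \<and> V i - V j \<unlhd> ?Z i j" if "1 \<le> i" "i < j" "j \<le> N" for i j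
    using main that by (simp add: majorized_iff_upto)
qed

end
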